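(* Let $X$ be a topological space and $f:X\to X$ a continuous map. Then $f$ is chaotic on $X$ if and only if $f$ is transitive on $X$ and the periodic points of $f$ are dense in $X$.
   Context: The forward orbit of $x$ under $f$ is $O(x)=\{x,f(x),f^2(x),\dots\}$, where $f^n$ is the $n$-th iterate. A point $p\in X$ is periodic if $f^n(p)=p$ for some positive integer $n$. Transitive: for any two nonvoid open subsets $U,V$ of $X$ there is a positive integer $n$ such that $f^n(U)\cap V\neq\emptyset$. Chaotic: for any two nonvoid open subsets $U,V$ of $X$ there is a periodic point $p\in X$ of $f$ such that $U\cap O(p)\neq\emptyset$ and $V\cap O(p)\neq\emptyset$. *)

theory Defs
  imports "HOL-Analysis.Abstract_Topology"
begin

definition forward_orbit :: "('a \<Rightarrow> 'a) \<Rightarrow> 'a \<Rightarrow> 'a set" where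
  "forward_orbit f x = {(f ^^ n) x | n. True}"

definition periodic_points :: "'a topology \<Rightarrow> ('a \<Rightarrow> 'a) \<Rightarrow> 'a set" where
  "periodic_points X f = {p \<in> topspace X. \<exists>n>0. (f ^^ n) p = p}"

definition transitive_map :: "'a topology \<Rightarrow> ('a \<Rightarrow> 'a) \<Rightarrow> bool" where
  "transitive_map X f \<longleftrightarrow>
    (\<forall>U V. openin X U \<and> U \<noteq> {} \<and> openin X V \<and> V \<noteq> {} \<longrightarrow>
      (\<exists>n>0. (f ^^ n) ` U \<inter> V \<noteq> {}))"

definition chaotic_map :: "'a topology \<Rightarrow> ('a \<Rightarrow> 'a) \<Rightarrow> bool" where
  "chaotic_map X f \<longleftrightarrow>
    (\<forall>U V. openin X U \<and> U \<noteq> {} \<and> openin X V \<and> V \<noteq> {} \<longrightarrow>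
      (\<exists>p \<in> periodic_points X f. U \<inter> forward_orbit f p \<noteq> {} \<and> V \<inter> forward_orbit f p \<noteq> {}))"

end

theory Submission imports Defs begin

text \<open>The orbit of a periodic point is a cycle: all its points are periodic
  (\<open>forward_orbit_subset_periodic_points\<close>), and each is reached from any other in a
  positive number of steps (\<open>periodic_orbit_reaches\<close>). So a periodic orbit meeting
  \<open>U\<close> and \<open>V\<close> carries a point of \<open>U\<close> into \<open>V\<close>,
  and a periodic orbit meeting an open set puts a periodic point in it. Conversely, transitivity
  gives an \<open>n\<close> for which the part of \<open>U\<close> that \<open>f ^^ n\<close> sends
  into \<open>V\<close> is nonempty. By continuity that part is open, so density places a periodic
  point in it, and the orbit of this point meets both sets.\<close>

lemma funpow_fixed_point_mult:
  assumes "(f ^^ k) p = p"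
  shows "(f ^^ (k * m)) p = p"
  by (induction m) (simp_all add: assms funpow_add)

lemma continuous_map_funpow:
  assumes "continuous_map X X f"
  shows "continuous_map X X (f ^^ n)"
proof (induction n)
  case (Suc n)
  then show ?case
    unfolding funpow.simps by (rule continuous_map_compose[OF _ assms])
qed (simp add: id_def)

text \<open>Iterates of \<open>f\<close> commute, so a period of \<open>p\<close> is a period of
  every point of its orbit. Continuity keeps the orbit inside \<open>topspace X\<close>.\<close>

lemma forward_orbit_subset_periodic_points:
  assumes f: "continuous_map X X f" and p: "p \<in> periodic_points X f"
  shows "forward_orbit f p \<subseteq> periodic_points X f"
proof
  fix y assume "y \<in> forward_orbit f p"
  then obtain a where y: "y = (f ^^ a) p"
    by (auto simp: forward_orbit_def)
  obtain k where "k > 0" and k: "(f ^^ k) p = p" and "p \<in> topspace X"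
    using p by (auto simp: periodic_points_def)
  have "(f ^^ k) y = (f ^^ (a + k)) p"
    by (simp only: y add.commute[of a] funpow_add o_apply)
  also have "\<dots> = y"
    by (simp add: y k funpow_add)
  finally have "(f ^^ k) y = y" .
  moreover have "y \<in> topspace X"
    using continuous_map_funpow[OF f, of a] \<open>p \<in> topspace X\<close>
    by (auto simp: y continuous_map_def)
  ultimately show "y \<in> periodic_points X f"
    using \<open>k > 0\<close> by (auto simp: periodic_points_def)
qed

lemma periodic_orbit_reaches:
  assumes p: "p \<in> periodic_points X f"
    and x: "x \<in> forward_orbit f p" and y: "y \<in> forward_orbit f p"
  obtains n where "n > 0" "(f ^^ n) x = y"
proof -
  obtain k where "k > 0" and k: "(f ^^ k) p = p"
    using p by (auto simp: periodic_points_def)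
  obtain a b where a: "x = (f ^^ a) p" and b: "y = (f ^^ b) p"
    using x y by (auto simp: forward_orbit_def)
  \<comment> \<open>To get from time \<open>a\<close> to time \<open>b\<close>, add a multiple of
    the period \<open>k\<close> to \<open>b\<close> before subtracting \<open>a\<close>. The
    multiple \<open>k * Suc a\<close> exceeds \<open>a\<close>, so the subtraction on naturals is
    exact and \<open>n\<close> is positive even when \<open>x = y\<close>.\<close>
  have le: "a < k * Suc a"
    using mult_le_mono1[of 1 k "Suc a"] \<open>k > 0\<close> by simp
  define n where "n = b + k * Suc a - a"
  have "n > 0" and n: "n + a = b + k * Suc a"
    using le by (simp_all add: n_def)
  have "(f ^^ n) x = (f ^^ (n + a)) p"
    by (simp only: a funpow_add o_apply)
  also have "\<dots> = y"
    by (simp only: n b funpow_add o_apply funpow_fixed_point_mult[OF k])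
  finally show thesis
    using that \<open>n > 0\<close> by blast
qed

lemma chaotic_imp_transitive:
  assumes "chaotic_map X f"
  shows "transitive_map X f"
  unfolding transitive_map_def
proof (intro allI impI)
  fix U V assume "openin X U \<and> U \<noteq> {} \<and> openin X V \<and> V \<noteq> {}"
  then obtain p x y where "p \<in> periodic_points X f" "x \<in> U" "x \<in> forward_orbit f p"
    "y \<in> V" "y \<in> forward_orbit f p"
    using assms unfolding chaotic_map_def by blast
  then show "\<exists>n>0. (f ^^ n) ` U \<inter> V \<noteq> {}"
    by (metis periodic_orbit_reaches IntI empty_iff imageI)
qed

lemma chaotic_imp_dense_periodic_points:
  assumes f: "continuous_map X X f" and "chaotic_map X f"
  shows "X closure_of (periodic_points X f) = topspace X"
  unfolding dense_intersects_open
proof (intro allI impI)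
  fix T assume "openin X T \<and> T \<noteq> {}"
  \<comment> \<open>Both open sets in the definition of chaos are taken to be \<open>T\<close>. The
    point \<open>p\<close> may lie outside \<open>T\<close>; the periodic point sought is one on its
    orbit.\<close>
  then obtain p where "p \<in> periodic_points X f" "T \<inter> forward_orbit f p \<noteq> {}"
    using \<open>chaotic_map X f\<close> unfolding chaotic_map_def by blast
  then show "periodic_points X f \<inter> T \<noteq> {}"
    using forward_orbit_subset_periodic_points[OF f] by blast
qed

lemma transitive_dense_periodic_points_imp_chaotic:
  assumes f: "continuous_map X X f" and trans: "transitive_map X f"
    and dense: "X closure_of (periodic_points X f) = topspace X"
  shows "chaotic_map X f"
  unfolding chaotic_map_def
proof (intro allI impI)
  fix U V assume UV: "openin X U \<and> U \<noteq> {} \<and> openin X V \<and> V \<noteq> {}"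
  then obtain n u where u: "u \<in> U" "(f ^^ n) u \<in> V"
    using trans unfolding transitive_map_def by blast
  \<comment> \<open>Any periodic point of \<open>W\<close> will do: its orbit is in \<open>U\<close>
    at time 0 and in \<open>V\<close> at time \<open>n\<close>.\<close>
  define W where "W = U \<inter> {x \<in> topspace X. (f ^^ n) x \<in> V}"
  have "openin X W"
    unfolding W_def using UV continuous_map_funpow[OF f]
    by (blast intro: openin_continuous_map_preimage)
  moreover have "u \<in> W"
    using u UV openin_subset by (auto simp: W_def)
  ultimately obtain p where p: "p \<in> periodic_points X f" "p \<in> W"
    using dense unfolding dense_intersects_open by blast
  have "p \<in> forward_orbit f p"
    unfolding forward_orbit_def by (auto intro: exI[of _ 0])
  moreover have "(f ^^ n) p \<in> forward_orbit f p"
    unfolding forward_orbit_def by blast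
  ultimately show "\<exists>p \<in> periodic_points X f.
      U \<inter> forward_orbit f p \<noteq> {} \<and> V \<inter> forward_orbit f p \<noteq> {}"
    using p by (auto simp: W_def)
qed

theorem mainTheorem3:
  fixes X :: "'a topology" and f :: "'a \<Rightarrow> 'a"
  assumes "continuous_map X X f"
  shows "chaotic_map X f \<longleftrightarrow>
    transitive_map X f \<and> X closure_of (periodic_points X f) = topspace X"
  using assms chaotic_imp_transitive chaotic_imp_dense_periodic_points
    transitive_dense_periodic_points_imp_chaotic by blast

end
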